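(* Let $a<b$ be real numbers and let $X=C([a,b])$ with the norm $\|\cdot\|_\infty$. Let $(\ell,G,F)$ and $(\widetilde\ell,\widetilde G,\widetilde F)$ be two sets of BVP data on $[a,b]$, and let $T,\widetilde T\colon X\to X$ be the corresponding Green operators $$(Tx)(t)=\ell(t)+\int_a^bG(t,s)F(s,x(s))\,ds,\qquad(\widetilde Tx)(t)=\widetilde\ell(t)+\int_a^b\widetilde G(t,s)\widetilde F(s,x(s))\,ds .$$ Let $R>0$, $C=\{x\in X:\|x\|_\infty\le R\}$ and $0\le L<1$. Assume $T(C)\subseteq C$, $\widetilde T(C)\subseteq C$, and that $T$ and $\widetilde T$ are both $L$-Lipschitz on $C$ with respect to $\|\cdot\|_\infty$. Let $x^\ast\in C$ be a fixed point of $T$ and $\widetilde x^\ast\in C$ a fixed point of $\widetilde T$. Then $$\|x^\ast-\widetilde x^\ast\|_\infty\le\frac{1}{1-L}\,\varepsilon_C(T,\widetilde T),\qquad \varepsilon_C(T,\widetilde T):=\sup_{x\in C}\|Tx-\widetilde Tx\|_\infty .$$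
   Context: A triple $(\ell,G,F)$ is a set of BVP data on $[a,b]$ if: $\ell\in X$; $G\colon[a,b]\times[a,b]\to\mathbb R$ is measurable with $M_G:=\sup_{t\in[a,b]}\int_a^b|G(t,s)|\,ds<\infty$; $F\colon[a,b]\times\mathbb R\to\mathbb R$ satisfies $|F(t,u)-F(t,v)|\le L_F|u-v|$ for all $t\in[a,b]$, $u,v\in\mathbb R$, with a constant $L_F\ge0$; and $M_{F_0}:=\sup_{t\in[a,b]}|F(t,0)|<\infty$. The formulas for $T$ and $\widetilde T$ are assumed to define maps $X\to X$. *)

theory Defs
  imports "HOL-Analysis.Analysis"
begin

text \<open>
  Elements of \<^term>\<open>mspace (cfunspace X m)\<close> are \<^const>\<open>extensional\<close>, i.e. \<^const>\<open>undefined\<close>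
  outside the domain, so equality of two elements means equality on the interval.
\<close>

definition C_ab :: "real \<Rightarrow> real \<Rightarrow> (real \<Rightarrow> real) set" where
  "C_ab a b = mspace (cfunspace (top_of_set {a..b}) euclidean_metric)"

definition supnorm :: "real \<Rightarrow> real \<Rightarrow> (real \<Rightarrow> real) \<Rightarrow> real" where
  "supnorm a b x = (SUP t\<in>{a..b}. \<bar>x t\<bar>)"

lemma C_ab_iff: "x \<in> C_ab a b \<longleftrightarrow> x \<in> extensional {a..b} \<and> continuous_on {a..b} x"
proof -
  have "bounded (x ` {a..b})" if "continuous_on {a..b} x"
    using that by (intro compact_imp_bounded compact_continuous_image) auto
  then show ?thesis
    by (auto simp: C_ab_def mtopology_of_def)
qed

lemma mdist_C_ab:
  assumes "a \<le> b" "x \<in> C_ab a b" "y \<in> C_ab a b"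
  shows "mdist (cfunspace (top_of_set {a..b}) euclidean_metric) x y = supnorm a b (x - y)"
  using assms
  by (auto simp: C_ab_def mdist_cfunspace_eq_mdist_funspace Met_TC.fdist_def Met_TC.fspace_def
      supnorm_def dist_real_def)

text \<open>
  Measurability is Lebesgue measurability. Joint Lebesgue measurability of \<open>G\<close> yields measurable
  sections only for almost every \<open>t\<close>, whereas the supremum of the integrals of \<open>\<bar>G t s\<bar>\<close> over
  all \<open>t\<close> presupposes it for every \<open>t\<close>; hence the third clause. For Borel \<open>G\<close> it is automatic.
  The suprema are taken in \<^typ>\<open>ennreal\<close>, so that being finite is a genuine condition.
\<close>

definition bvp_data ::
  "real \<Rightarrow> real \<Rightarrow> (real \<Rightarrow> real) \<Rightarrow> (real \<Rightarrow> real \<Rightarrow> real) \<Rightarrow> (real \<Rightarrow> real \<Rightarrow> real) \<Rightarrow> bool" where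
  "bvp_data a b l G F \<longleftrightarrow>
     l \<in> C_ab a b \<and>
     (\<lambda>(t, s). G t s) \<in> borel_measurable (lebesgue_on ({a..b} \<times> {a..b})) \<and>
     (\<forall>t\<in>{a..b}. G t \<in> borel_measurable (lebesgue_on {a..b})) \<and>
     (SUP t\<in>{a..b}. \<integral>\<^sup>+ s. ennreal \<bar>G t s\<bar> \<partial>lebesgue_on {a..b}) < \<infinity> \<and>
     (\<exists>L\<^sub>F\<ge>0. \<forall>t\<in>{a..b}. \<forall>u v. \<bar>F t u - F t v\<bar> \<le> L\<^sub>F * \<bar>u - v\<bar>) \<and>
     (SUP t\<in>{a..b}. ennreal \<bar>F t 0\<bar>) < \<infinity>"

definition green_op ::
  "real \<Rightarrow> real \<Rightarrow> (real \<Rightarrow> real) \<Rightarrow> (real \<Rightarrow> real \<Rightarrow> real) \<Rightarrow> (real \<Rightarrow> real \<Rightarrow> real)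
     \<Rightarrow> (real \<Rightarrow> real) \<Rightarrow> real \<Rightarrow> real" where
  "green_op a b l G F x =
     (\<lambda>t\<in>{a..b}. l t + (\<integral>s. G t s * F s (x s) \<partial>lebesgue_on {a..b}))"

text \<open>
  The formula defines a map from \<^term>\<open>C_ab a b\<close> to itself. Integrability has to be required
  explicitly: \<open>F\<close> is not assumed measurable in its first argument, and the Bochner integral of a
  non-integrable function is \<open>0\<close>.
\<close>

definition green_op_maps ::
  "real \<Rightarrow> real \<Rightarrow> (real \<Rightarrow> real) \<Rightarrow> (real \<Rightarrow> real \<Rightarrow> real) \<Rightarrow> (real \<Rightarrow> real \<Rightarrow> real) \<Rightarrow> bool" where
  "green_op_maps a b l G F \<longleftrightarrow>
     (\<forall>x\<in>C_ab a b.
        (\<forall>t\<in>{a..b}. integrable (lebesgue_on {a..b}) (\<lambda>s. G t s * F s (x s))) \<and>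
        green_op a b l G F x \<in> C_ab a b)"

definition lipschitz_sup ::
  "real \<Rightarrow> real \<Rightarrow> real \<Rightarrow> (real \<Rightarrow> real) set \<Rightarrow> ((real \<Rightarrow> real) \<Rightarrow> real \<Rightarrow> real) \<Rightarrow> bool" where
  "lipschitz_sup a b L C T \<longleftrightarrow>
     (\<forall>x\<in>C. \<forall>y\<in>C. supnorm a b (T x - T y) \<le> L * supnorm a b (x - y))"

text \<open>
  A supremum in \<^typ>\<open>real\<close>, meaningful only if the set is bounded above; this is so when both
  operators map \<open>C\<close> into a bounded set, see \<open>bdd_above_op_dist\<close>.
\<close>

definition op_dist ::
  "real \<Rightarrow> real \<Rightarrow> (real \<Rightarrow> real) set \<Rightarrow> ((real \<Rightarrow> real) \<Rightarrow> real \<Rightarrow> real)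
     \<Rightarrow> ((real \<Rightarrow> real) \<Rightarrow> real \<Rightarrow> real) \<Rightarrow> real" where
  "op_dist a b C T T' = (SUP x\<in>C. supnorm a b (T x - T' x))"

lemma abs_le_supnorm:
  assumes "x \<in> C_ab a b" "t \<in> {a..b}"
  shows "\<bar>x t\<bar> \<le> supnorm a b x"
proof -
  have "bounded ((\<lambda>t. \<bar>x t\<bar>) ` {a..b})"
    using assms by (intro compact_imp_bounded compact_continuous_image continuous_intros)
      (auto simp: C_ab_iff)
  then show ?thesis
    unfolding supnorm_def using assms(2) by (intro cSUP_upper bounded_imp_bdd_above)
qed

lemma bdd_above_op_dist:
  assumes "a \<le> b"
    and "T ` C \<subseteq> {x \<in> C_ab a b. supnorm a b x \<le> R}"
    and "T' ` C \<subseteq> {x \<in> C_ab a b. supnorm a b x \<le> R}"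
  shows "bdd_above ((\<lambda>x. supnorm a b (T x - T' x)) ` C)"
proof (rule bdd_aboveI2)
  fix x assume "x \<in> C"
  then have T: "T x \<in> C_ab a b" "supnorm a b (T x) \<le> R"
    and T': "T' x \<in> C_ab a b" "supnorm a b (T' x) \<le> R"
    using assms by auto
  show "supnorm a b (T x - T' x) \<le> R + R"
    unfolding supnorm_def
  proof (rule cSUP_least)
    fix t assume "t \<in> {a..b}"
    then show "\<bar>(T x - T' x) t\<bar> \<le> R + R"
      using abs_le_supnorm[OF T(1)] abs_le_supnorm[OF T'(1)] T(2) T'(2) by fastforce
  qed (use assms(1) in simp)
qed

end

theory Submission
  imports Defs
begin

text \<open>This is the standard perturbation estimate for fixed points of a contraction. Insert
  \<open>T y\<close> between \<open>x = T x\<close> and \<open>y = T' y\<close> by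
  \<open>supnorm_diff_triangle\<close>. Contractivity of \<open>T\<close> bounds the first leg by
  \<open>L\<close> times the distance from \<open>x\<close> to \<open>y\<close>; the second leg
  compares the two operators at the single point \<open>y\<close> of \<open>C\<close>, so
  \<open>op_dist\<close> bounds it. Since \<open>L < 1\<close>, the first bound can be absorbed on
  the left.\<close>

text \<open>Inherited from the metric space \<open>cfunspace\<close>, whose distance is
  \<open>supnorm\<close> of the difference by \<open>mdist_C_ab\<close>; no supremum has to be
  handled directly.\<close>

lemma supnorm_diff_triangle:
  assumes "a \<le> b" and "u \<in> C_ab a b" "v \<in> C_ab a b" "w \<in> C_ab a b"
  shows "supnorm a b (u - w) \<le> supnorm a b (u - v) + supnorm a b (v - w)"
  using mdist_triangle[of u "cfunspace (top_of_set {a..b}) euclidean_metric" v w] assms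
  by (simp only: mdist_C_ab flip: C_ab_def)

theorem theorem9p5:
  fixes a b R L :: real
    and l l' :: "real \<Rightarrow> real"
    and G G' F F' :: "real \<Rightarrow> real \<Rightarrow> real"
    and T T' :: "(real \<Rightarrow> real) \<Rightarrow> real \<Rightarrow> real"
    and C :: "(real \<Rightarrow> real) set"
    and x y :: "real \<Rightarrow> real"
  assumes "a < b"
    and "bvp_data a b l G F" and "bvp_data a b l' G' F'"
    and "green_op_maps a b l G F" and "green_op_maps a b l' G' F'"
    and "T = green_op a b l G F" and "T' = green_op a b l' G' F'"
    and "R > 0" and "C = {z \<in> C_ab a b. supnorm a b z \<le> R}"
    and "0 \<le> L" and "L < 1"
    and "T ` C \<subseteq> C" and "T' ` C \<subseteq> C"
    and "lipschitz_sup a b L C T" and "lipschitz_sup a b L C T'"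
    and "x \<in> C" and "T x = x"
    and "y \<in> C" and "T' y = y"
  shows "supnorm a b (x - y) \<le> 1 / (1 - L) * op_dist a b C T T'"
proof -
  have C_ab: "x \<in> C_ab a b" "y \<in> C_ab a b" "T y \<in> C_ab a b"
    using assms by auto
  \<comment> \<open>A real \<open>SUP\<close> bounds its members only if the set is bounded above;
    here both operators map \<open>C\<close> into the ball of radius \<open>R\<close>.\<close>
  have "bdd_above ((\<lambda>z. supnorm a b (T z - T' z)) ` C)"
    using assms by (intro bdd_above_op_dist) auto
  then have dist: "supnorm a b (T y - T' y) \<le> op_dist a b C T T'"
    unfolding op_dist_def using \<open>y \<in> C\<close> by (intro cSUP_upper)
  have "supnorm a b (x - y) \<le> supnorm a b (x - T y) + supnorm a b (T y - y)"
    using \<open>a < b\<close> C_ab by (intro supnorm_diff_triangle) auto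
  also have "\<dots> = supnorm a b (T x - T y) + supnorm a b (T y - T' y)"
    by (simp only: \<open>T x = x\<close> \<open>T' y = y\<close>)
  also have "\<dots> \<le> L * supnorm a b (x - y) + op_dist a b C T T'"
    using \<open>lipschitz_sup a b L C T\<close> \<open>x \<in> C\<close> \<open>y \<in> C\<close> dist
    by (intro add_mono) (auto simp: lipschitz_sup_def)
  \<comment> \<open>Move the term with factor \<open>L\<close> to the left and divide by
    \<open>1 - L\<close>, which is positive.\<close>
  finally show ?thesis
    using \<open>L < 1\<close> by (simp add: field_simps)
qed

end
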